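(* Let $\&$ be a left continuous t-norm on $[0,1]$. The following statements are equivalent: (1) For all $p,q,u\in[0,1]$, $(p\& q)\wedge u=((p\wedge u)\& q)\vee(p\&(q\wedge u))$. (2) For all $p,u\in[0,1]$, if $u\le p\& p$ then $u\& p=u$. (3) There is a countable (possibly empty) family $\{[a_i,b_i]\subseteq[0,1)\mid i\in I\}$ of pairwise disjoint closed intervals such that for all $p,q\in[0,1]$, $$p\& q=\begin{cases} a_i & \text{if } p,q\in[a_i,b_i]\text{ for some } i\in I,\\ p\wedge q & \text{otherwise.}\end{cases}$$
   Context: A left continuous t-norm on $[0,1]$ is a commutative, associative binary operation $\&$ on $[0,1]$ with unit $1$ that preserves arbitrary suprema in each variable. Here $\wedge$ and $\vee$ denote minimum and maximum. *)

theory Defs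
  imports Complex_Main "HOL-Library.Lub_Glb" "HOL-Library.Disjoint_Sets"
begin

text \<open>
  A left continuous t-norm is represented by a function on the reals of which only the
  restriction to \<open>{0..1}\<close> matters.  Suprema are taken in the complete lattice
  \<open>[0,1]\<close>, i.e. via \<^term>\<open>isLub {0..1}\<close>.  The supremum of the empty set is therefore
  \<open>0\<close> (unlike \<^term>\<open>Sup {} :: real\<close>, which has no such meaning), so preservation of the
  empty supremum says that \<open>0\<close> is absorbing.
\<close>

definition preserves_sups01 :: "(real \<Rightarrow> real) \<Rightarrow> bool" where
  "preserves_sups01 f \<longleftrightarrow>
     (\<forall>S s. S \<subseteq> {0..1} \<longrightarrow> isLub {0..1} S s \<longrightarrow> isLub {0..1} (f ` S) (f s))"

definition left_continuous_tnorm :: "(real \<Rightarrow> real \<Rightarrow> real) \<Rightarrow> bool" where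
  "left_continuous_tnorm T \<longleftrightarrow>
     (\<forall>p\<in>{0..1}. \<forall>q\<in>{0..1}. T p q \<in> {0..1}) \<and>
     (\<forall>p\<in>{0..1}. \<forall>q\<in>{0..1}. T p q = T q p) \<and>
     (\<forall>p\<in>{0..1}. \<forall>q\<in>{0..1}. \<forall>r\<in>{0..1}. T (T p q) r = T p (T q r)) \<and>
     (\<forall>p\<in>{0..1}. T p 1 = p \<and> T 1 p = p) \<and>
     (\<forall>p\<in>{0..1}. preserves_sups01 (\<lambda>q. T p q)) \<and>
     (\<forall>q\<in>{0..1}. preserves_sups01 (\<lambda>p. T p q))"

text \<open>
  Every countable family is, up to reindexing, indexed by a set of naturals, so the index
  set is taken to be of type \<^typ>\<open>nat set\<close>; it may be empty, finite or infinite.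
  Intervals are nonempty; degenerate ones \<open>[a, a]\<close> are allowed.
\<close>

definition disjoint_closed_intervals ::
    "nat set \<Rightarrow> (nat \<Rightarrow> real) \<Rightarrow> (nat \<Rightarrow> real) \<Rightarrow> bool" where
  "disjoint_closed_intervals I a b \<longleftrightarrow>
     (\<forall>i\<in>I. a i \<le> b i \<and> {a i..b i} \<subseteq> {0..<1}) \<and>
     disjoint_family_on (\<lambda>i. {a i..b i}) I"

end

theory Submission
  imports Defs "HOL-Library.Countable_Set"
begin

text \<open>
  Taking \<open>p = q\<close> in (1) gives (2), and (3) implies (2) by a direct check. Assume (2). Then
  every square \<open>e = q \<odot> q\<close> is idempotent, so for \<open>p \<le> q\<close> there are two cases: either
  \<open>p \<le> q \<odot> q\<close> and \<open>p \<odot> q = p\<close>, or \<open>q \<odot> q < p\<close> and \<open>p \<odot> p = p \<odot> q = q \<odot> q\<close>. Condition (1)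
  follows by inspection. For (3), the fibres of the monotone map \<open>p \<mapsto> p \<odot> p\<close> are intervals
  with least element their common square; left continuity makes them closed, and the
  nondegenerate ones are the required family. It is countable since each of its members
  contains a rational.
\<close>

lemma isLub_iff:
  "isLub R S s \<longleftrightarrow> s \<in> R \<and> (\<forall>x\<in>S. x \<le> s) \<and> (\<forall>t\<in>R. (\<forall>x\<in>S. x \<le> t) \<longrightarrow> s \<le> t)"
  by (auto simp: isLub_def leastP_def isUb_def setle_def setge_def)

section \<open>Monotonicity and left continuity of the t-norm\<close>

locale left_cont_tnorm =
  fixes T :: "real \<Rightarrow> real \<Rightarrow> real"  (infixl "\<odot>" 75)
  assumes tnorm: "left_continuous_tnorm (\<odot>)"
begin

lemma closed: "p \<in> {0..1} \<Longrightarrow> q \<in> {0..1} \<Longrightarrow> p \<odot> q \<in> {0..1}"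
  and commute: "p \<in> {0..1} \<Longrightarrow> q \<in> {0..1} \<Longrightarrow> p \<odot> q = q \<odot> p"
  and assoc: "p \<in> {0..1} \<Longrightarrow> q \<in> {0..1} \<Longrightarrow> r \<in> {0..1} \<Longrightarrow> p \<odot> q \<odot> r = p \<odot> (q \<odot> r)"
  and right_unit: "p \<in> {0..1} \<Longrightarrow> p \<odot> 1 = p"
  and sups_left: "q \<in> {0..1} \<Longrightarrow> preserves_sups01 (\<lambda>p. p \<odot> q)"
  using tnorm unfolding left_continuous_tnorm_def by blast+

text \<open>Preservation of the supremum of the two-element set \<open>{p, q}\<close>, which is
  \<open>q\<close>, makes \<open>q \<odot> r\<close> an upper bound of
  \<open>p \<odot> r\<close>.\<close>

lemma mono_left:
  assumes "p \<in> {0..1}" "q \<in> {0..1}" "r \<in> {0..1}" "p \<le> q"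
  shows "p \<odot> r \<le> q \<odot> r"
proof -
  have "isLub {0..1} {p, q} q"
    using assms by (auto simp: isLub_iff)
  then have "isLub {0..1} ((\<lambda>p. p \<odot> r) ` {p, q}) (q \<odot> r)"
    using sups_left[of r] assms(1-3) unfolding preserves_sups01_def
    by (metis bot.extremum insert_subset)
  then show ?thesis
    by (auto simp: isLub_iff)
qed

lemma mono:
  assumes "p \<in> {0..1}" "q \<in> {0..1}" "p' \<in> {0..1}" "q' \<in> {0..1}" "p \<le> p'" "q \<le> q'"
  shows "p \<odot> q \<le> p' \<odot> q'"
  using mono_left[of p p' q] mono_left[of q q' p'] assms commute by fastforce

lemma le_left:
  assumes "p \<in> {0..1}" "q \<in> {0..1}"
  shows "p \<odot> q \<le> p"
  using mono[of p q p 1] assms right_unit[of p] by auto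

lemma le_right:
  assumes "p \<in> {0..1}" "q \<in> {0..1}"
  shows "p \<odot> q \<le> q"
  using le_left[of q p] assms commute by auto

text \<open>The image of \<open>S\<close> is the singleton \<open>{e}\<close>, so left continuity
  forces the value at \<open>Sup S\<close> to be \<open>e\<close>. This later shows that fibres of
  the squaring map contain their suprema.\<close>

lemma Sup_constant:
  assumes "S \<noteq> {}" "S \<subseteq> {0..1}" "c \<in> {0..1}" and const: "\<And>x. x \<in> S \<Longrightarrow> x \<odot> c = e"
  shows "Sup S \<odot> c = e"
proof -
  have bdd: "bdd_above S"
    using assms(2) by (meson bdd_above_Icc bdd_above_mono)
  have "Sup S \<in> {0..1}"
  proof -
    obtain x where "x \<in> S" using assms(1) by blast
    then have "0 \<le> x" "x \<le> Sup S" using bdd assms(2) by (auto intro: cSup_upper)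
    moreover have "Sup S \<le> 1" using assms by (auto intro!: cSup_least)
    ultimately show ?thesis by simp
  qed
  then have "isLub {0..1} S (Sup S)"
    using assms(1) bdd by (auto simp: isLub_iff intro: cSup_upper cSup_least)
  then have "isLub {0..1} ((\<lambda>x. x \<odot> c) ` S) (Sup S \<odot> c)"
    using sups_left[of c] assms by (auto simp: preserves_sups01_def)
  moreover have "(\<lambda>x. x \<odot> c) ` S = {e}"
    using assms(1) const by auto
  \<comment> \<open>Least upper bounds are compared only with bounds in \<open>{0..1}\<close>, so
    \<open>e\<close> must lie there to serve as one.\<close>
  moreover have "e \<in> {0..1}"
    using assms closed by (metis ex_in_conv subsetD)
  ultimately show ?thesis
    by (force simp: isLub_iff)
qed

end

section \<open>Products under condition (2), and condition (1)\<close>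

locale square_unital_tnorm = left_cont_tnorm +
  assumes square_unital: "p \<in> {0..1} \<Longrightarrow> u \<in> {0..1} \<Longrightarrow> u \<le> p \<odot> p \<Longrightarrow> u \<odot> p = u"
begin

text \<open>Condition (2) with \<open>u = p \<odot> p\<close> lets one factor \<open>p\<close> be
  absorbed; associativity lets the second be absorbed in the same way.\<close>

lemma square_idem:
  assumes "p \<in> {0..1}"
  shows "(p \<odot> p) \<odot> (p \<odot> p) = p \<odot> p"
  using assms closed square_unital[of p "p \<odot> p"] assoc[of "p \<odot> p" p p] by auto

text \<open>Since \<open>e = q \<odot> q\<close> is idempotent, monotonicity closes the chain
  \<open>e = e \<odot> e \<le> p \<odot> p \<le> p \<odot> q \<le> q \<odot> q = e\<close>.\<close>

lemma absorbed:
  assumes "p \<in> {0..1}" "q \<in> {0..1}" "q \<odot> q \<le> p" "p \<le> q"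
  shows "p \<odot> q = q \<odot> q" "p \<odot> p = q \<odot> q"
proof -
  have "q \<odot> q \<le> p \<odot> p"
    using mono[of "q \<odot> q" "q \<odot> q" p p] square_idem[of q] closed assms by auto
  moreover have "p \<odot> p \<le> p \<odot> q" "p \<odot> q \<le> q \<odot> q"
    using mono assms by auto
  ultimately show "p \<odot> q = q \<odot> q" "p \<odot> p = q \<odot> q"
    by auto
qed

lemma min_distrib_ordered:
  assumes "p \<in> {0..1}" "q \<in> {0..1}" "u \<in> {0..1}" "p \<le> q"
  shows "min (p \<odot> q) u = max (min p u \<odot> q) (p \<odot> min q u)"
proof (cases "p \<le> q \<odot> q")
  case True
  \<comment> \<open>Here \<open>q\<close> acts as a unit on everything below \<open>p\<close>, so
    both sides are \<open>min p u\<close>: the second argument of the maximum does not exceed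
    it.\<close>
  have "p \<odot> q = p" and "min p u \<odot> q = min p u"
    using square_unital[of q p] square_unital[of q "min p u"] assms True by auto
  moreover have "p \<odot> min q u \<le> p" "p \<odot> min q u \<le> min q u"
    using le_left[of p "min q u"] le_right[of p "min q u"] assms by auto
  ultimately show ?thesis
    by auto
next
  case False
  define e where "e = q \<odot> q"
  have e: "e \<in> {0..1}" "e \<odot> e = e" "e < p" "p \<odot> q = e"
    using closed[of q q] square_idem[of q] absorbed(1)[of p q] assms False by (auto simp: e_def)
  show ?thesis
  proof (cases "u \<le> e")
    case True
    \<comment> \<open>As \<open>u \<le> e < p \<le> q\<close>, both inner minima are
      \<open>u\<close>, and both sides equal \<open>u\<close>.\<close>
    have "u \<odot> q = u" "p \<odot> u \<le> u"
      using square_unital[of q u] le_right[of p u] assms True by (auto simp: e_def)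
    then show ?thesis
      using True e assms by (auto simp: min_def max_def)
  next
    case u: False
    \<comment> \<open>All factors now lie between \<open>e\<close> and \<open>q\<close>, whose
      squares are both \<open>e\<close>, so both products collapse to \<open>e\<close>.\<close>
    have "e \<le> min p u \<odot> q" "min p u \<odot> q \<le> e" "e \<le> p \<odot> min q u" "p \<odot> min q u \<le> e"
      using mono[of e e "min p u" q] mono[of "min p u" q q q]
        mono[of e e p "min q u"] mono[of p "min q u" q q] e assms u
      by (auto simp: e_def)
    then show ?thesis
      using u e by auto
  qed
qed

lemma min_distrib:
  assumes "p \<in> {0..1}" "q \<in> {0..1}" "u \<in> {0..1}"
  shows "min (p \<odot> q) u = max (min p u \<odot> q) (p \<odot> min q u)"
proof (cases "p \<le> q")
  case True
  then show ?thesis using min_distrib_ordered assms by blast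
next
  case False
  then have "min (q \<odot> p) u = max (min q u \<odot> p) (q \<odot> min p u)"
    using min_distrib_ordered[of q p u] assms by simp
  then show ?thesis
    using assms commute[of q p] commute[of "min q u" p] commute[of q "min p u"]
    by (simp add: max.commute min.coboundedI1 min_le_iff_disj)
qed

section \<open>Fibres of the squaring map\<close>

definition fibre :: "real \<Rightarrow> real set" where
  "fibre e = {p \<in> {0..1}. p \<odot> p = e}"

text \<open>These squares will be the left endpoints of the intervals. Leaving out one-point fibres
  is what keeps the family countable.\<close>

definition nondeg_squares :: "real set" where
  "nondeg_squares = {e. \<exists>p \<in> fibre e. e < p}"

lemma square_in_fibre: "p \<in> {0..1} \<Longrightarrow> p \<odot> p \<in> fibre (p \<odot> p)"
  by (auto simp: fibre_def square_idem closed simp del: atLeastAtMost_iff)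

text \<open>By monotonicity the product lies between the two squares, both equal to
  \<open>e\<close>.\<close>

lemma prod_in_fibre:
  assumes "p \<in> fibre e" "q \<in> fibre e"
  shows "p \<odot> q = e"
proof (cases "p \<le> q")
  case True
  then show ?thesis
    using assms mono[of p p p q] mono[of p q q q] by (auto simp: fibre_def)
next
  case False
  then show ?thesis
    using assms mono[of q q p q] mono[of p q p p] by (auto simp: fibre_def)
qed

lemma fibre_eq:
  assumes "fibre e \<noteq> {}"
  shows "fibre e = {e..Sup (fibre e)}"
proof -
  define b where "b = Sup (fibre e)"
  have sub: "fibre e \<subseteq> {0..1}"
    by (auto simp: fibre_def)
  have bdd: "bdd_above (fibre e)"
    using sub by (meson bdd_above_Icc bdd_above_mono)
  have e: "e \<in> fibre e"
    using assms square_in_fibre by (auto simp: fibre_def)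
  have ub: "x \<le> b" if "x \<in> fibre e" for x
    using that bdd by (auto simp: b_def intro: cSup_upper)
  have b01: "b \<in> {0..1}"
    using ub[OF e] e sub assms by (auto simp: b_def intro!: cSup_least)
  \<comment> \<open>Left continuity acts on one variable at a time: first replace one factor by
    \<open>b\<close> with \<open>y\<close> fixed, then commute and replace the other with
    \<open>b\<close> fixed.\<close>
  have "b \<odot> y = e" if "y \<in> fibre e" for y
    unfolding b_def using that sub assms prod_in_fibre by (intro Sup_constant) auto
  then have "y \<odot> b = e" if "y \<in> fibre e" for y
    using that commute[of y b] b01 sub by auto
  then have "b \<odot> b = e"
    using Sup_constant[OF assms sub b01] by (simp add: b_def)
  \<comment> \<open>The squares of both endpoints are \<open>e\<close>, which squeezes every square
    between them.\<close>
  have "p \<in> fibre e" if "p \<in> {e..b}" for p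
    using that e mono[of e e p p] mono[of p p b b] b01 \<open>b \<odot> b = e\<close>
    by (auto simp: fibre_def)
  moreover have "p \<in> {e..b}" if "p \<in> fibre e" for p
    using that ub le_left[of p p] by (auto simp: fibre_def)
  ultimately show ?thesis
    unfolding b_def by blast
qed

lemma nondeg_squares_fibre:
  assumes "e \<in> nondeg_squares"
  shows "fibre e \<noteq> {}" "fibre e \<subseteq> {0..<1}"
proof -
  obtain p where p: "p \<in> fibre e" "e < p"
    using assms by (auto simp: nondeg_squares_def)
  then show "fibre e \<noteq> {}" by blast
  \<comment> \<open>Otherwise \<open>e = 1 \<odot> 1 = 1\<close>, leaving no room for
    \<open>p\<close> above \<open>e\<close>.\<close>
  have "1 \<notin> fibre e"
    using p right_unit[of 1] by (auto simp: fibre_def)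
  then show "fibre e \<subseteq> {0..<1}"
    by (auto simp: fibre_def less_le)
qed

text \<open>A nondegenerate fibre contains a rational, whose square is the given \<open>e\<close>.
  Rationals outside \<open>{0..1}\<close> are harmless, as only an inclusion is claimed.\<close>

lemma countable_nondeg_squares: "countable nondeg_squares"
proof -
  have "nondeg_squares \<subseteq> (\<lambda>r. r \<odot> r) ` \<rat>"
  proof
    fix e assume "e \<in> nondeg_squares"
    then obtain p where p: "p \<in> fibre e" "e < p"
      by (auto simp: nondeg_squares_def)
    obtain r where r: "r \<in> \<rat>" "e < r" "r < p"
      using Rats_dense_in_real[OF p(2)] by blast
    have "{e..p} \<subseteq> fibre e"
      using fibre_eq[of e] p
      by (metis atLeastAtMost_iff atLeastatMost_subset_iff empty_iff order_refl)
    then have "r \<in> fibre e"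
      using r by auto
    then have "r \<odot> r = e"
      by (simp add: fibre_def)
    then show "e \<in> (\<lambda>r. r \<odot> r) ` \<rat>"
      using r by blast
  qed
  then show ?thesis
    using countable_rat countable_image countable_subset by blast
qed

section \<open>The interval family of condition (3)\<close>

lemma interval_family:
  "\<exists>I a b. disjoint_closed_intervals I a b \<and>
     (\<forall>p\<in>{0..1}. \<forall>q\<in>{0..1}.
       (\<forall>i\<in>I. p \<in> {a i..b i} \<and> q \<in> {a i..b i} \<longrightarrow> p \<odot> q = a i) \<and>
       ((\<nexists>i. i \<in> I \<and> p \<in> {a i..b i} \<and> q \<in> {a i..b i}) \<longrightarrow> p \<odot> q = min p q))"
proof -
  \<comment> \<open>Enumerating the countable set makes \<open>a\<close> a bijection from
    \<open>I\<close> onto \<open>nondeg_squares\<close>, whether that set is empty, finite or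
    infinite.\<close>
  define I where "I = to_nat_on nondeg_squares ` nondeg_squares"
  define a where "a = from_nat_into nondeg_squares"
  define b where "b = (\<lambda>i. Sup (fibre (a i)))"
  have a: "a i \<in> nondeg_squares" if "i \<in> I" for i
    using that countable_nondeg_squares by (auto simp: I_def a_def)
  have inj: "i = j" if "i \<in> I" "j \<in> I" "a i = a j" for i j
    using that countable_nondeg_squares by (auto simp: I_def a_def)
  have surj: "\<exists>i\<in>I. a i = e" if "e \<in> nondeg_squares" for e
    using that countable_nondeg_squares by (auto simp: I_def a_def)
  have fib: "{a i..b i} = fibre (a i)" if "i \<in> I" for i
    using fibre_eq[OF nondeg_squares_fibre(1)[OF a[OF that]]] by (simp add: b_def)
  have "disjoint_closed_intervals I a b"
    unfolding disjoint_closed_intervals_def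
  proof (intro conjI ballI)
    fix i assume i: "i \<in> I"
    show "a i \<le> b i" "{a i..b i} \<subseteq> {0..<1}"
      using fib[OF i] nondeg_squares_fibre[OF a[OF i]] by auto
  next
    show "disjoint_family_on (\<lambda>i. {a i..b i}) I"
      unfolding disjoint_family_on_def
    proof (intro ballI impI)
      fix i j assume "i \<in> I" "j \<in> I" "i \<noteq> j"
      \<comment> \<open>A common point would have both \<open>a i\<close> and \<open>a j\<close> as
        its square.\<close>
      then show "{a i..b i} \<inter> {a j..b j} = {}"
        using fib inj by (auto simp: fibre_def simp del: Int_atLeastAtMost)
    qed
  qed
  moreover have "p \<odot> q = a i" if "i \<in> I" "p \<in> {a i..b i}" "q \<in> {a i..b i}" for p q i
    using that fib prod_in_fibre by blast
  moreover have "p \<odot> q = min p q"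
    if pq: "p \<in> {0..1}" "q \<in> {0..1}"
      and none: "\<nexists>i. i \<in> I \<and> p \<in> {a i..b i} \<and> q \<in> {a i..b i}" for p q
  proof -
    \<comment> \<open>If this fails, (2) gives \<open>y \<odot> y < x\<close>. Then
      \<open>absorbed\<close> puts \<open>x\<close> and \<open>y\<close> in the fibre of
      \<open>y \<odot> y\<close>, which is nondegenerate and hence a member of the family.\<close>
    have *: "x \<odot> y = x"
      if "x \<in> {0..1}" "y \<in> {0..1}" "x \<le> y"
        and none: "\<nexists>i. i \<in> I \<and> x \<in> {a i..b i} \<and> y \<in> {a i..b i}" for x y
    proof (rule ccontr)
      assume "x \<odot> y \<noteq> x"
      then have lt: "y \<odot> y < x"
        using square_unital[of y x] that by force
      have fibs: "x \<in> fibre (y \<odot> y)" "y \<in> fibre (y \<odot> y)"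
        using absorbed[of x y] lt that by (auto simp: fibre_def)
      then have "y \<odot> y \<in> nondeg_squares"
        using lt by (auto simp: nondeg_squares_def)
      then obtain i where i: "i \<in> I" "a i = y \<odot> y"
        using surj by blast
      then have "x \<in> {a i..b i}" "y \<in> {a i..b i}"
        using fib[OF i(1)] fibs by simp_all
      then show False
        using none i(1) by blast
    qed
    show ?thesis
      using *[of p q] *[of q p] commute[OF pq] pq none by (cases "p \<le> q") auto
  qed
  ultimately show ?thesis
    by blast
qed

end

section \<open>From the interval formula back to condition (2)\<close>

lemma interval_family_square_unital:
  fixes T :: "real \<Rightarrow> real \<Rightarrow> real"  (infixl "\<odot>" 75)
  assumes family: "\<forall>p\<in>{0..1}. \<forall>q\<in>{0..1}.
      (\<forall>i\<in>I. p \<in> {a i..b i} \<and> q \<in> {a i..b i} \<longrightarrow> p \<odot> q = a i) \<and>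
      ((\<nexists>i. i \<in> I \<and> p \<in> {a i..b i} \<and> q \<in> {a i..b i}) \<longrightarrow> p \<odot> q = min p q)"
    and p: "p \<in> {0..1}" and u: "u \<in> {0..1}" and le: "u \<le> p \<odot> p"
  shows "u \<odot> p = u"
proof -
  have inside: "x \<odot> y = a i"
    if "x \<in> {0..1}" "y \<in> {0..1}" "i \<in> I" "x \<in> {a i..b i}" "y \<in> {a i..b i}" for x y i
    using family that by blast
  have outside: "x \<odot> y = min x y"
    if "x \<in> {0..1}" "y \<in> {0..1}" "\<nexists>i. i \<in> I \<and> x \<in> {a i..b i} \<and> y \<in> {a i..b i}" for x y
    using family that by blast
  \<comment> \<open>In a shared interval, \<open>u \<le> p \<odot> p = a i \<le> u\<close> and
    \<open>u \<odot> p = a i\<close>. Otherwise \<open>u \<odot> p\<close> is the minimum, which is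
    \<open>u\<close> because \<open>u \<le> p \<odot> p \<le> p\<close>.\<close>
  show ?thesis
  proof (cases "\<exists>i\<in>I. p \<in> {a i..b i} \<and> u \<in> {a i..b i}")
    case True
    then obtain i where i: "i \<in> I" "p \<in> {a i..b i}" "u \<in> {a i..b i}"
      by blast
    then have "p \<odot> p = a i" "u \<odot> p = a i"
      using inside p u by blast+
    then show ?thesis
      using i le by auto
  next
    case False
    have "p \<odot> p \<le> p"
    proof (cases "\<exists>i\<in>I. p \<in> {a i..b i}")
      case True
      then show ?thesis using inside[of p p] p by fastforce
    next
      case False
      then show ?thesis using outside[of p p] p by auto
    qed
    moreover have "u \<odot> p = min u p"
      using outside[of u p] False p u by blast
    ultimately show ?thesis
      using le by simp
  qed
qed

theorem proposition3p1:
  fixes T :: "real \<Rightarrow> real \<Rightarrow> real"  (infixl "\<odot>" 75)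
  assumes "left_continuous_tnorm (\<odot>)"
  shows "((\<forall>p\<in>{0..1}. \<forall>q\<in>{0..1}. \<forall>u\<in>{0..1}.
             min (p \<odot> q) u = max (min p u \<odot> q) (p \<odot> min q u))
          \<longleftrightarrow>
          (\<forall>p\<in>{0..1}. \<forall>u\<in>{0..1}. u \<le> p \<odot> p \<longrightarrow> u \<odot> p = u)) \<and>
         ((\<forall>p\<in>{0..1}. \<forall>u\<in>{0..1}. u \<le> p \<odot> p \<longrightarrow> u \<odot> p = u)
          \<longleftrightarrow>
          (\<exists>I a b. disjoint_closed_intervals I a b \<and>
             (\<forall>p\<in>{0..1}. \<forall>q\<in>{0..1}.
               (\<forall>i\<in>I. p \<in> {a i..b i} \<and> q \<in> {a i..b i} \<longrightarrow> p \<odot> q = a i) \<and>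
               ((\<nexists>i. i \<in> I \<and> p \<in> {a i..b i} \<and> q \<in> {a i..b i}) \<longrightarrow> p \<odot> q = min p q))))"
proof -
  interpret left_cont_tnorm T
    by unfold_locales (fact assms)
  have sq: "square_unital_tnorm T" if U: "\<forall>p\<in>{0..1}. \<forall>u\<in>{0..1}. u \<le> p \<odot> p \<longrightarrow> u \<odot> p = u"
    by unfold_locales (use U in blast)
  show ?thesis
  proof (intro conjI iffI)
    assume D: "\<forall>p\<in>{0..1}. \<forall>q\<in>{0..1}. \<forall>u\<in>{0..1}.
      min (p \<odot> q) u = max (min p u \<odot> q) (p \<odot> min q u)"
    show "\<forall>p\<in>{0..1}. \<forall>u\<in>{0..1}. u \<le> p \<odot> p \<longrightarrow> u \<odot> p = u"
    proof (intro ballI impI)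
      fix p u :: real
      assume pu: "p \<in> {0..1}" "u \<in> {0..1}" "u \<le> p \<odot> p"
      have "u \<le> p"
        using pu le_left[of p p] by auto
      \<comment> \<open>With \<open>q = p\<close> all three minima in (1) reduce to
        \<open>u\<close>, and commutativity identifies the two remaining products.\<close>
      then have "u = max (u \<odot> p) (p \<odot> u)"
        using D[rule_format, of p p u] pu by (simp add: min_absorb2)
      then show "u \<odot> p = u"
        using commute[of p u] pu by simp
    qed
  next
    assume "\<forall>p\<in>{0..1}. \<forall>u\<in>{0..1}. u \<le> p \<odot> p \<longrightarrow> u \<odot> p = u"
    then show "\<forall>p\<in>{0..1}. \<forall>q\<in>{0..1}. \<forall>u\<in>{0..1}.
      min (p \<odot> q) u = max (min p u \<odot> q) (p \<odot> min q u)"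
      using square_unital_tnorm.min_distrib[OF sq] by blast
  next
    assume "\<forall>p\<in>{0..1}. \<forall>u\<in>{0..1}. u \<le> p \<odot> p \<longrightarrow> u \<odot> p = u"
    then show "\<exists>I a b. disjoint_closed_intervals I a b \<and>
      (\<forall>p\<in>{0..1}. \<forall>q\<in>{0..1}.
        (\<forall>i\<in>I. p \<in> {a i..b i} \<and> q \<in> {a i..b i} \<longrightarrow> p \<odot> q = a i) \<and>
        ((\<nexists>i. i \<in> I \<and> p \<in> {a i..b i} \<and> q \<in> {a i..b i}) \<longrightarrow> p \<odot> q = min p q))"
      by (rule square_unital_tnorm.interval_family[OF sq])
  next
    assume "\<exists>I a b. disjoint_closed_intervals I a b \<and>
      (\<forall>p\<in>{0..1}. \<forall>q\<in>{0..1}.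
        (\<forall>i\<in>I. p \<in> {a i..b i} \<and> q \<in> {a i..b i} \<longrightarrow> p \<odot> q = a i) \<and>
        ((\<nexists>i. i \<in> I \<and> p \<in> {a i..b i} \<and> q \<in> {a i..b i}) \<longrightarrow> p \<odot> q = min p q))"
    then show "\<forall>p\<in>{0..1}. \<forall>u\<in>{0..1}. u \<le> p \<odot> p \<longrightarrow> u \<odot> p = u"
    proof (elim exE conjE, intro ballI impI)
      fix I :: "nat set" and a b :: "nat \<Rightarrow> real" and p u :: real
      assume F: "\<forall>p\<in>{0..1}. \<forall>q\<in>{0..1}.
        (\<forall>i\<in>I. p \<in> {a i..b i} \<and> q \<in> {a i..b i} \<longrightarrow> p \<odot> q = a i) \<and>
        ((\<nexists>i. i \<in> I \<and> p \<in> {a i..b i} \<and> q \<in> {a i..b i}) \<longrightarrow> p \<odot> q = min p q)"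
      assume "p \<in> {0..1}" "u \<in> {0..1}" "u \<le> p \<odot> p"
      then show "u \<odot> p = u"
        by (rule interval_family_square_unital[OF F])
    qed
  qed
qed

end
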